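(* Consider a statistical model that is semi-regular at the realization parameter $\theta_*=0$ (the rank $r$ of the Fisher information matrix at $0$ satisfies $r>0$), and suppose that conditions (A1) and (A2) of the context hold, with the integer $m\ge 1$ defined there. Then the Taylor expansion of the Kullback-Leibler divergence $K(\theta)$ at $\theta=0$ can be expressed as $$K(\theta)=\frac12\,\mathbb{E}_X\left[\left\{F_1(X|\theta_1,\ldots,\theta_r)+F_m(X|\theta_{r+1},\ldots,\theta_d)\right\}^2\right]+R(\theta),$$ where the power series $R(\theta)$ (the "higher order terms") contains none of the following: (i) terms of order up to $2m$ that consist only of $\theta_{r+1},\ldots,\theta_d$; (ii) terms that are of first order in $\theta_1,\ldots,\theta_r$ and of order up to $m$ in $\theta_{r+1},\ldots,\theta_d$; (iii) second-order terms that consist only of $\theta_1,\ldots,\theta_r$.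
   Context: Setting. $p(x|\theta)$, $x\in\chi$, is a statistical model (family of probability densities) with parameter $\theta=(\theta_1,\ldots,\theta_d)\in\Theta\subset\mathbb{R}^d$, $d\ge1$. The true density $q$ is realizable: there is $\theta_*$ with $q(x)=p(x|\theta_* )$ a.s.; by translation $\theta_*=0$. $X$ is a random variable with density $q$ and $\mathbb{E}_X$ is expectation with respect to $X$. The log-likelihood ratio function is $f(x|\theta)=\log\frac{p(x|\theta_* )}{p(x|\theta)}$ and the Kullback-Leibler divergence is $K(\theta)=\mathbb{E}_X[f(X|\theta)]$. Standing assumptions: $f$ is $L^2$-integrable and analytic in $\theta$ around $\theta_*$, $K$ is analytic around $\theta_*$, and expectations and partial derivatives in $\theta$ can be interchanged. The Fisher information matrix at $\theta_*$ is the $d\times d$ matrix with entries $\mathrm{Cov}\left(\partial_{\theta_i}\log p(X|\theta)|_{\theta=\theta_*},\ \partial_{\theta_j}\log p(X|\theta)|_{\theta=\theta_*}\right)$, and $r$ denotes its rank. Notation. For a subset of the coordinates, written $\theta_{a},\ldots,\theta_{b}$, and $n\ge 1$, $$F_n(X|\theta_a,\ldots,\theta_b)=\sum_{\substack{i_a+\cdots+i_b=n\\ i_a,\ldots,i_b\in\mathbb{Z}_{\ge0}}}\frac{1}{i_a!\cdots i_b!}\left.\frac{\partial^n f(X|\theta)}{\partial\theta_a^{i_a}\cdots\partial\theta_b^{i_b}}\right|_{\theta=0}\theta_a^{i_a}\cdots\theta_b^{i_b}.$$ Random variables are called linearly independent if no nontrivial real linear combination of them is zero almost surely. (A1) The $r$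 random variables $\left.\frac{\partial f(X|\theta)}{\partial\theta_1}\right|_{\theta=0},\ldots,\left.\frac{\partial f(X|\theta)}{\partial\theta_r}\right|_{\theta=0}$ are linearly independent. (A2) For the remaining $d-r$ parameters, $m\ge1$ is the largest integer such that $F_1(X|\theta_{r+1},\ldots,\theta_d)=\cdots=F_{m-1}(X|\theta_{r+1},\ldots,\theta_d)=0$ a.s. (i.e. all derivatives of $f(X|\theta)$ at $0$ with respect to $\theta_{r+1},\ldots,\theta_d$ of order up to $m-1$ vanish a.s.). Convention: the value $m=1$ is treated as the case $r=d$ (no remaining parameters). *)

theory Defs
  imports "HOL-Probability.Probability"
begin

section \<open>Multi-indices, partial derivatives and power series\<close>

text \<open>
  Points of the parameter space are vectors \<open>\<theta> :: real ^ 'd\<close>. The coordinates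
  \<open>\<theta>\<^sub>1, \<dots>, \<theta>\<^sub>d\<close> are ordered by a linear order on the index type \<open>'d\<close>, and \<open>d = CARD('d)\<close>.
  A multi-index is a function \<open>'d \<Rightarrow> nat\<close>.
\<close>

definition mpow :: "('d \<Rightarrow> nat) \<Rightarrow> real ^ 'd \<Rightarrow> real"
  where "mpow \<alpha> \<theta> = (\<Prod>i\<in>UNIV. (\<theta> $ i) ^ \<alpha> i)"

definition mfact :: "('d::finite \<Rightarrow> nat) \<Rightarrow> real"
  where "mfact \<alpha> = (\<Prod>i\<in>UNIV. fact (\<alpha> i))"

definition partial :: "'d \<Rightarrow> (real ^ 'd \<Rightarrow> real) \<Rightarrow> real ^ 'd \<Rightarrow> real"
  where "partial i g \<theta> = deriv (\<lambda>t. g (\<theta> + t *\<^sub>R axis i 1)) 0"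

text \<open>
  The iterated partial derivative; the derivative in the largest coordinate is taken first.
  As for \<^const>\<open>deriv\<close>, the value is only meaningful if the derivatives exist.
\<close>

definition mderiv ::
    "('d::{finite,linorder} \<Rightarrow> nat) \<Rightarrow>
     (real ^ 'd::{finite,linorder} \<Rightarrow> real) \<Rightarrow> real ^ 'd::{finite,linorder} \<Rightarrow> real"
  where "mderiv \<alpha> g = foldr (\<lambda>i. partial i ^^ \<alpha> i) (sorted_list_of_set UNIV) g"

text \<open>
  In the reals \<^const>\<open>has_sum\<close> is unconditional, hence absolute, convergence.
\<close>

definition has_power_series_at ::
    "(real ^ 'd \<Rightarrow> real) \<Rightarrow> (('d \<Rightarrow> nat) \<Rightarrow> real) \<Rightarrow> real ^ 'd \<Rightarrow> bool"
  where "has_power_series_at g c a \<longleftrightarrow>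
    (\<forall>\<^sub>F \<theta> in nhds a. ((\<lambda>\<alpha>. c \<alpha> * mpow \<alpha> (\<theta> - a)) has_sum g \<theta>) UNIV)"

definition real_analytic_at :: "(real ^ 'd \<Rightarrow> real) \<Rightarrow> real ^ 'd \<Rightarrow> bool"
  where "real_analytic_at g a \<longleftrightarrow> (\<exists>c. has_power_series_at g c a)"

definition first_coords :: "nat \<Rightarrow> 'd::{finite,linorder} set"
  where "first_coords r = {i. card {..<i} < r}"

text \<open>
  The homogeneous part of degree \<open>n\<close> of the Taylor expansion of \<open>g\<close> at \<open>0\<close>
  in the coordinates in \<open>S\<close> only. Applied to \<open>f(X|\<cdot>)\<close> it is \<open>F\<^sub>n(X|\<theta>\<^sub>i, i \<in> S)\<close>.
\<close>

definition taylor_part ::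
    "'d::{finite,linorder} set \<Rightarrow> nat \<Rightarrow>
     (real ^ 'd::{finite,linorder} \<Rightarrow> real) \<Rightarrow> real ^ 'd::{finite,linorder} \<Rightarrow> real"
  where "taylor_part S n g \<theta> =
    (\<Sum>\<alpha> | (\<forall>i. i \<notin> S \<longrightarrow> \<alpha> i = 0) \<and> (\<Sum>i\<in>S. \<alpha> i) = n.
       1 / mfact \<alpha> * mderiv \<alpha> g 0 * mpow \<alpha> \<theta>)"

section \<open>Statistical models with realization parameter \<open>0\<close>\<close>

definition density_family :: "'x measure \<Rightarrow> 'p set \<Rightarrow> ('x \<Rightarrow> 'p \<Rightarrow> real) \<Rightarrow> bool"
  where "density_family \<mu> \<Theta> p \<longleftrightarrow>
    (\<forall>\<theta>\<in>\<Theta>. (\<forall>x\<in>space \<mu>. 0 \<le> p x \<theta>) \<and> integrable \<mu> (\<lambda>x. p x \<theta>) \<and>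
       (\<integral>x. p x \<theta> \<partial>\<mu>) = 1)"

definition llr :: "('x \<Rightarrow> 'p::zero \<Rightarrow> real) \<Rightarrow> 'x \<Rightarrow> 'p \<Rightarrow> real"
  where "llr p x \<theta> = ln (p x 0 / p x \<theta>)"

definition KL :: "'w measure \<Rightarrow> ('w \<Rightarrow> 'x) \<Rightarrow> ('x \<Rightarrow> 'p::zero \<Rightarrow> real) \<Rightarrow> 'p \<Rightarrow> real"
  where "KL P X p \<theta> = (\<integral>\<omega>. llr p (X \<omega>) \<theta> \<partial>P)"

definition covariance :: "'w measure \<Rightarrow> ('w \<Rightarrow> real) \<Rightarrow> ('w \<Rightarrow> real) \<Rightarrow> real"
  where "covariance P Y Z = (\<integral>\<omega>. (Y \<omega> - (\<integral>\<omega>. Y \<omega> \<partial>P)) * (Z \<omega> - (\<integral>\<omega>. Z \<omega> \<partial>P)) \<partial>P)"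

definition fisher_information ::
    "'w measure \<Rightarrow> ('w \<Rightarrow> 'x) \<Rightarrow> ('x \<Rightarrow> real ^ 'd \<Rightarrow> real) \<Rightarrow> real ^ 'd ^ 'd"
  where "fisher_information P X p =
    (\<chi> i j. covariance P (\<lambda>\<omega>. partial i (\<lambda>\<theta>. ln (p (X \<omega>) \<theta>)) 0)
                         (\<lambda>\<omega>. partial j (\<lambda>\<theta>. ln (p (X \<omega>) \<theta>)) 0))"

text \<open>
  Interchange of expectation and partial derivatives of every order, at \<open>0\<close>. Integrability is
  demanded explicitly because the integral of a non-integrable function is \<open>0\<close> by convention.
\<close>

definition expectation_deriv_interchange ::
    "'w measure \<Rightarrow> ('w \<Rightarrow> real ^ 'd::{finite,linorder} \<Rightarrow> real) \<Rightarrow> bool"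
  where "expectation_deriv_interchange P g \<longleftrightarrow>
    (\<forall>\<alpha>. integrable P (\<lambda>\<omega>. mderiv \<alpha> (g \<omega>) 0) \<and>
       mderiv \<alpha> (\<lambda>\<theta>. \<integral>\<omega>. g \<omega> \<theta> \<partial>P) 0 = (\<integral>\<omega>. mderiv \<alpha> (g \<omega>) 0 \<partial>P))"

definition lin_indep_rvs :: "'w measure \<Rightarrow> 'i set \<Rightarrow> ('i \<Rightarrow> 'w \<Rightarrow> real) \<Rightarrow> bool"
  where "lin_indep_rvs P I Y \<longleftrightarrow>
    (\<forall>c. (AE \<omega> in P. (\<Sum>i\<in>I. c i * Y i \<omega>) = 0) \<longrightarrow> (\<forall>i\<in>I. c i = 0))"

definition taylor_parts_vanish_below ::
    "'w measure \<Rightarrow> ('w \<Rightarrow> real ^ 'd::{finite,linorder} \<Rightarrow> real) \<Rightarrow> 'd set \<Rightarrow> nat \<Rightarrow> bool"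
  where "taylor_parts_vanish_below P g S m \<longleftrightarrow>
    (\<forall>n\<in>{1..<m}. AE \<omega> in P. \<forall>\<theta>. taylor_part S n (g \<omega>) \<theta> = 0)"

end

theory Submission
  imports Defs
begin

text \<open>
  Give \<open>\<theta>\<^sub>1, \<dots>, \<theta>\<^sub>r\<close> weight \<open>m\<close> and the remaining coordinates weight \<open>1\<close>. By (A2) and
  \<open>f(X|0) = 0\<close>, almost surely \<open>f(X|\<cdot>)\<close> has no terms of weight less than \<open>m\<close>, and its part of
  weight exactly \<open>m\<close> is \<open>F = F\<^sub>1(X|\<theta>\<^sub>1, \<dots>, \<theta>\<^sub>r) + F\<^sub>m(X|\<theta>\<^sub>r\<^sub>+\<^sub>1, \<dots>, \<theta>\<^sub>d)\<close>. Since cubes of \<open>f\<close>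
  start at weight \<open>3m\<close>, up to weight \<open>2m\<close> the ratio \<open>p(X|\<theta>) / p(X|0) = exp (- f)\<close> agrees with
  \<open>1 - f + F\<^sup>2 / 2\<close>. The ratio has expectation \<open>1\<close> for every \<open>\<theta>\<close>, so its higher coefficients
  have expectation \<open>0\<close>; hence the coefficients of \<open>K = E f\<close> and of \<open>E F\<^sup>2 / 2\<close> coincide up to
  weight \<open>2m\<close>, and the terms listed in (i)--(iii) all have weight at most \<open>2m\<close>. The same
  identity expresses the coefficients of \<open>F\<^sup>2\<close> by integrable ones, which gives the
  integrability of \<open>F\<^sup>2\<close>.
\<close>

section \<open>Differentiating power series term by term\<close>

lemma mpow_add: "mpow (\<lambda>i. \<alpha> i + \<beta> i) \<theta> = mpow \<alpha> \<theta> * mpow \<beta> \<theta>"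
  by (simp add: mpow_def power_add prod.distrib)

lemma mpow_zero: "mpow \<alpha> 0 = (if \<alpha> = (\<lambda>_. 0) then 1 else 0)"
  by (auto simp: mpow_def fun_eq_iff power_0_left)

lemma mpow_index_zero [simp]: "mpow (\<lambda>_. 0) \<theta> = 1"
  by (simp add: mpow_def)

lemma abs_mpow: "\<bar>mpow \<alpha> \<theta>\<bar> = mpow \<alpha> (\<chi> i. \<bar>\<theta> $ i\<bar>)"
  by (simp add: mpow_def abs_prod power_abs)

lemma mpow_split: "mpow \<alpha> \<theta> = (\<theta> $ i) ^ \<alpha> i * (\<Prod>j\<in>UNIV - {i}. (\<theta> $ j) ^ \<alpha> j)"
  unfolding mpow_def by (rule prod.remove) auto

lemma mfact_nonzero [simp]: "mfact \<alpha> \<noteq> 0"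
  by (simp add: mfact_def)

lemma finite_multi_index_atMost: "finite {..\<gamma> :: 'd::finite \<Rightarrow> nat}"
proof -
  have "{..\<gamma>} = PiE UNIV (\<lambda>i. {..\<gamma> i})"
    by (auto simp: le_fun_def PiE_def Pi_def)
  thus ?thesis by (simp add: finite_PiE)
qed

text \<open>The binomial terms with \<open>j \<ge> 2\<close> contain
  \<open>t ^ j = (t / \<rho>) ^ j * \<rho> ^ j\<close>, and since
  \<open>\<bar>t / \<rho>\<bar> \<le> 1\<close> the factor \<open>(t / \<rho>) ^ j\<close> is at
  most \<open>(t / \<rho>)\<^sup>2\<close> in absolute value. The rest sums to at most
  \<open>(2 * \<rho>) ^ n\<close>, so the dependence on \<open>t\<close> is the same for all
  degrees.\<close>

lemma power_first_order_remainder: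
  fixes x t \<rho> :: real
  assumes "\<bar>x\<bar> \<le> \<rho>" "\<bar>t\<bar> \<le> \<rho>" "\<rho> > 0"
  shows "\<bar>(x + t) ^ n - x ^ n - t * (real n * x ^ (n - 1))\<bar> \<le> (t / \<rho>)\<^sup>2 * (2 * \<rho>) ^ n"
proof (cases n)
  case 0
  thus ?thesis by simp
next
  case (Suc k)
  define s where "s = t / \<rho>"
  have t: "t = s * \<rho>" using assms by (simp add: s_def)
  have s1: "\<bar>s\<bar> \<le> 1" using assms by (simp add: s_def)
  let ?u = "\<lambda>j. real (n choose j) * t ^ j * x ^ (n - j)"
  have "(t + x) ^ n = (\<Sum>j\<le>n. ?u j)"
    by (simp add: binomial_ring)
  also have "{..n} = insert 0 (insert 1 {2..n})"
    using Suc by auto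
  also have "sum ?u \<dots> = x ^ n + (t * (real n * x ^ (n - 1)) + (\<Sum>j\<in>{2..n}. ?u j))"
    by simp
  finally have eq: "(x + t) ^ n - x ^ n - t * (real n * x ^ (n - 1)) = (\<Sum>j\<in>{2..n}. ?u j)"
    by (simp add: add.commute)
  have "\<bar>\<Sum>j\<in>{2..n}. ?u j\<bar> \<le> (\<Sum>j\<in>{2..n}. s\<^sup>2 * (real (n choose j) * \<rho> ^ j * \<rho> ^ (n - j)))"
  proof (rule sum_abs[THEN order_trans], rule sum_mono)
    fix j assume j: "j \<in> {2..n}"
    have "\<bar>s\<bar> ^ j \<le> \<bar>s\<bar> ^ 2" using j s1 by (intro power_decreasing) auto
    hence "\<bar>s\<bar> ^ j \<le> s\<^sup>2" by simp
    moreover have "\<bar>x\<bar> ^ (n - j) \<le> \<rho> ^ (n - j)" using assms by (intro power_mono) auto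
    ultimately have "\<bar>s\<bar> ^ j * (real (n choose j) * \<rho> ^ j) * \<bar>x\<bar> ^ (n - j)
        \<le> s\<^sup>2 * (real (n choose j) * \<rho> ^ j) * \<rho> ^ (n - j)"
      using assms by (intro mult_mono) auto
    thus "\<bar>?u j\<bar> \<le> s\<^sup>2 * (real (n choose j) * \<rho> ^ j * \<rho> ^ (n - j))"
      using assms by (simp add: t abs_mult power_abs power_mult_distrib mult_ac)
  qed
  also have "\<dots> \<le> (\<Sum>j\<le>n. s\<^sup>2 * (real (n choose j) * \<rho> ^ j * \<rho> ^ (n - j)))"
    using assms by (intro sum_mono2) auto
  also have "\<dots> = s\<^sup>2 * (\<rho> + \<rho>) ^ n"
    unfolding binomial_ring by (simp add: sum_distrib_left)
  also have "\<rho> + \<rho> = 2 * \<rho>"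
    by simp
  finally show ?thesis
    unfolding eq s_def .
qed

lemma norm_le_card_times_bound:
  fixes x :: "real ^ 'd" and \<rho> :: real
  assumes "\<And>i. \<bar>x $ i\<bar> \<le> \<rho>"
  shows "norm x \<le> CARD('d) * \<rho>"
proof -
  have "norm x \<le> (\<Sum>i\<in>UNIV. \<bar>x $ i\<bar>)"
    by (rule norm_le_l1_cart)
  also have "\<dots> \<le> (\<Sum>i\<in>(UNIV :: 'd set). \<rho>)"
    by (intro sum_mono assms)
  finally show ?thesis by simp
qed

text \<open>Boxes replace balls because monomials are bounded coordinate by coordinate, with the
  maximum at the corner of the box.\<close>

lemma eventually_nhds_zero_box:
  fixes Q :: "real ^ 'd \<Rightarrow> bool"
  assumes "eventually Q (nhds 0)"
  obtains \<rho> where "\<rho> > 0" "\<And>x. (\<And>i. \<bar>x $ i\<bar> \<le> \<rho>) \<Longrightarrow> Q x"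
proof -
  obtain e where e: "e > 0" "\<And>x. dist x 0 < e \<Longrightarrow> Q x"
    using assms by (auto simp: eventually_nhds_metric)
  define \<rho> where "\<rho> = e / (2 * CARD('d))"
  have "\<rho> > 0" using e by (simp add: \<rho>_def)
  moreover have "Q x" if "\<And>i. \<bar>x $ i\<bar> \<le> \<rho>" for x
  proof (rule e)
    have "norm x \<le> CARD('d) * \<rho>" using that by (rule norm_le_card_times_bound)
    also have "\<dots> < e" using e by (simp add: \<rho>_def)
    finally show "dist x 0 < e" by simp
  qed
  ultimately show thesis by (rule that)
qed

lemma eventually_nhds_zero_boxI:
  fixes Q :: "real ^ 'd \<Rightarrow> bool"
  assumes "\<rho> > 0" "\<And>x. (\<And>i. \<bar>x $ i\<bar> \<le> \<rho>) \<Longrightarrow> Q x"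
  shows "eventually Q (nhds 0)"
  unfolding eventually_nhds_metric
proof (intro exI conjI allI impI)
  fix x :: "real ^ 'd" assume x: "dist x 0 < \<rho>"
  show "Q x"
  proof (rule assms)
    fix i
    have "\<bar>x $ i\<bar> \<le> norm x" by (rule component_le_norm_cart)
    thus "\<bar>x $ i\<bar> \<le> \<rho>" using x by simp
  qed
qed (use assms in auto)

lemma DERIV_quadratic_remainder:
  fixes \<phi> :: "real \<Rightarrow> real"
  assumes "\<rho> > 0" and "\<And>t. \<bar>t\<bar> \<le> \<rho> \<Longrightarrow> \<bar>\<phi> t - \<phi> 0 - t * D\<bar> \<le> C * t\<^sup>2"
  shows "DERIV \<phi> 0 :> D"
proof -
  have "((\<lambda>t. (\<phi> t - \<phi> 0) / t - D) \<longlongrightarrow> 0) (at 0)"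
  proof (rule Lim_null_comparison)
    have "eventually (\<lambda>t. \<bar>t\<bar> < \<rho>) (at (0::real))"
      using assms(1) by (auto simp: eventually_at intro!: exI[of _ \<rho>])
    thus "eventually (\<lambda>t. norm ((\<phi> t - \<phi> 0) / t - D) \<le> C * \<bar>t\<bar>) (at 0)"
      using eventually_at_ball'[of 1 "0::real" UNIV, simplified]
    proof eventually_elim
      case (elim t)
      have "norm ((\<phi> t - \<phi> 0) / t - D) = \<bar>\<phi> t - \<phi> 0 - t * D\<bar> / \<bar>t\<bar>"
        using elim by (simp add: field_simps flip: abs_divide)
      also have "\<dots> \<le> (C * t\<^sup>2) / \<bar>t\<bar>"
        using elim assms(2)[of t] by (intro divide_right_mono) auto
      also have "\<dots> = C * \<bar>t\<bar>"
        using elim by (simp add: power2_eq_square abs_if)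
      finally show ?case .
    qed
    show "((\<lambda>t. C * \<bar>t\<bar>) \<longlongrightarrow> 0) (at 0)"
      by (auto intro!: tendsto_eq_intros)
  qed
  hence "((\<lambda>t. (\<phi> t - \<phi> 0) / t) \<longlongrightarrow> D) (at 0)"
    by (rule LIM_zero_cancel)
  thus ?thesis by (simp add: DERIV_def)
qed

text \<open>Absolute convergence at the corner of a box gives a summable majorant for the
  second-order remainders of all monomials. The remainders therefore sum to a multiple of the square
  of \<open>t\<close>, and the difference quotient tends to the termwise derivative.\<close>

lemma has_power_series_at_partial:
  fixes g :: "real ^ 'd \<Rightarrow> real"
  assumes "has_power_series_at g c 0"
  shows "has_power_series_at (partial i g) (\<lambda>\<alpha>. real (Suc (\<alpha> i)) * c (\<alpha>(i := Suc (\<alpha> i)))) 0"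
proof -
  obtain \<rho>' where \<rho>': "\<rho>' > 0"
    "\<And>\<theta>. (\<And>i. \<bar>\<theta> $ i\<bar> \<le> \<rho>') \<Longrightarrow> ((\<lambda>\<alpha>. c \<alpha> * mpow \<alpha> (\<theta> - 0)) has_sum g \<theta>) UNIV"
    using eventually_nhds_zero_box assms[unfolded has_power_series_at_def] by blast
  \<comment> \<open>Half the radius: if \<open>t\<close> and all coordinates of
    \<open>\<theta>\<close> are at most \<open>\<rho>\<close> in absolute value, then moving
    \<open>\<theta>\<close> by \<open>t\<close> along axis \<open>i\<close> stays inside the box of
    convergence.\<close>
  define \<rho> where "\<rho> = \<rho>' / 2"
  have \<rho>: "\<rho> > 0" using \<rho>' by (simp add: \<rho>_def)
  have ser: "((\<lambda>\<alpha>. c \<alpha> * mpow \<alpha> \<theta>) has_sum g \<theta>) UNIV" if "\<And>i. \<bar>\<theta> $ i\<bar> \<le> 2 * \<rho>" for \<theta>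
    using \<rho>'(2)[of \<theta>] that by (simp add: \<rho>_def)
  define v :: "real ^ 'd" where "v = (\<chi> i. 2 * \<rho>)"
  define M where "M \<alpha> = \<bar>c \<alpha>\<bar> * mpow \<alpha> v" for \<alpha>
  have mv: "mpow \<alpha> v \<ge> 0" for \<alpha>
    using \<rho> by (auto simp: mpow_def v_def intro!: prod_nonneg)
  have "(\<lambda>\<alpha>. norm (c \<alpha> * mpow \<alpha> v)) summable_on UNIV"
    using ser[of v] \<rho> has_sum_imp_summable summable_on_iff_abs_summable_on_real
    by (fastforce simp: v_def)
  hence M: "M summable_on UNIV"
    using mv by (simp add: M_def[abs_def] abs_mult)
  define D where "D \<alpha> \<theta> = real (\<alpha> i) * (\<theta> $ i) ^ (\<alpha> i - 1) * (\<Prod>j\<in>UNIV - {i}. (\<theta> $ j) ^ \<alpha> j)"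
    for \<alpha> and \<theta> :: "real ^ 'd"
  have rest: "\<bar>\<Prod>j\<in>UNIV - {i}. (\<theta> $ j) ^ \<alpha> j\<bar> \<le> (\<Prod>j\<in>UNIV - {i}. (v $ j) ^ \<alpha> j)"
    if "\<And>i. \<bar>\<theta> $ i\<bar> \<le> \<rho>" for \<theta> :: "real ^ 'd" and \<alpha>
    unfolding abs_prod
  proof (intro prod_mono conjI)
    fix j
    have "\<bar>\<theta> $ j\<bar> \<le> 2 * \<rho>" using that[of j] \<rho> by linarith
    hence "\<bar>\<theta> $ j\<bar> ^ \<alpha> j \<le> (2 * \<rho>) ^ \<alpha> j"
      by (rule power_mono) auto
    thus "\<bar>(\<theta> $ j) ^ \<alpha> j\<bar> \<le> (v $ j) ^ \<alpha> j"
      by (simp add: v_def power_abs)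
  qed auto
  have D: "\<bar>c \<alpha> * D \<alpha> \<theta>\<bar> \<le> 1 / \<rho> * M \<alpha>" if \<theta>: "\<And>i. \<bar>\<theta> $ i\<bar> \<le> \<rho>" for \<theta> :: "real ^ 'd" and \<alpha>
  proof -
    \<comment> \<open>The bound \<open>n < 2 ^ n\<close> absorbs the factor produced by
      differentiation, and \<open>2 ^ n * \<rho> ^ (n - 1)\<close> equals
      \<open>(2 * \<rho>) ^ n / \<rho>\<close> for positive \<open>n\<close>. For exponent
      \<open>0\<close> the left side is \<open>0\<close>, so the truncated \<open>n - 1\<close> does
      no harm.\<close>
    have "\<bar>real (\<alpha> i) * (\<theta> $ i) ^ (\<alpha> i - 1)\<bar> \<le> 2 ^ \<alpha> i * \<rho> ^ (\<alpha> i - 1)"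
      using \<theta>[of i] \<rho> unfolding abs_mult power_abs
      by (intro mult_mono power_mono) (auto simp: of_nat_less_two_power less_imp_le)
    also have "\<dots> \<le> 1 / \<rho> * (v $ i) ^ \<alpha> i" if "\<alpha> i > 0"
      using \<rho> that by (cases "\<alpha> i") (auto simp: v_def power_mult_distrib)
    finally have 1: "\<bar>real (\<alpha> i) * (\<theta> $ i) ^ (\<alpha> i - 1)\<bar> \<le> 1 / \<rho> * (v $ i) ^ \<alpha> i"
      using \<rho> by (cases "\<alpha> i = 0") (auto simp: v_def)
    have "\<bar>D \<alpha> \<theta>\<bar> \<le> (1 / \<rho> * (v $ i) ^ \<alpha> i) * (\<Prod>j\<in>UNIV - {i}. (v $ j) ^ \<alpha> j)"
      unfolding D_def abs_mult[of "_ * _ ^ _"] using \<rho>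
      by (intro mult_mono 1 rest \<theta>) (auto simp: v_def)
    also have "\<dots> = 1 / \<rho> * mpow \<alpha> v" by (simp add: mpow_split[of _ _ i])
    finally have "\<bar>c \<alpha>\<bar> * \<bar>D \<alpha> \<theta>\<bar> \<le> \<bar>c \<alpha>\<bar> * (1 / \<rho> * mpow \<alpha> v)"
      by (intro mult_left_mono) auto
    thus ?thesis by (simp add: M_def abs_mult)
  qed
  have rem: "\<bar>c \<alpha> * mpow \<alpha> (\<theta> + t *\<^sub>R axis i 1) - c \<alpha> * mpow \<alpha> \<theta> - t * (c \<alpha> * D \<alpha> \<theta>)\<bar>
      \<le> (t / \<rho>)\<^sup>2 * M \<alpha>" if \<theta>: "\<And>i. \<bar>\<theta> $ i\<bar> \<le> \<rho>" and t: "\<bar>t\<bar> \<le> \<rho>" for \<theta> :: "real ^ 'd" and t \<alpha>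
  proof -
    let ?Q = "\<Prod>j\<in>UNIV - {i}. (\<theta> $ j) ^ \<alpha> j"
    let ?E = "(\<theta> $ i + t) ^ \<alpha> i - (\<theta> $ i) ^ \<alpha> i - t * (real (\<alpha> i) * (\<theta> $ i) ^ (\<alpha> i - 1))"
    have "mpow \<alpha> (\<theta> + t *\<^sub>R axis i 1) = (\<theta> $ i + t) ^ \<alpha> i * ?Q"
      by (auto simp: mpow_split[of _ _ i] axis_def intro!: prod.cong)
    hence "c \<alpha> * mpow \<alpha> (\<theta> + t *\<^sub>R axis i 1) - c \<alpha> * mpow \<alpha> \<theta> - t * (c \<alpha> * D \<alpha> \<theta>) = c \<alpha> * (?E * ?Q)"
      by (simp add: mpow_split[of _ _ i] D_def algebra_simps)
    hence "\<bar>c \<alpha> * mpow \<alpha> (\<theta> + t *\<^sub>R axis i 1) - c \<alpha> * mpow \<alpha> \<theta> - t * (c \<alpha> * D \<alpha> \<theta>)\<bar>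
        = \<bar>c \<alpha>\<bar> * (\<bar>?E\<bar> * \<bar>?Q\<bar>)"
      by (simp only: abs_mult)
    also have "\<dots> \<le> \<bar>c \<alpha>\<bar> * (((t / \<rho>)\<^sup>2 * (2 * \<rho>) ^ \<alpha> i) * (\<Prod>j\<in>UNIV - {i}. (v $ j) ^ \<alpha> j))"
      by (intro mult_left_mono mult_mono power_first_order_remainder rest \<theta> t \<rho>) (use \<rho> in auto)
    also have "\<dots> = \<bar>c \<alpha>\<bar> * ((t / \<rho>)\<^sup>2 * mpow \<alpha> v)" by (simp add: mpow_split[of _ _ i] v_def)
    finally show ?thesis
      by (simp only: M_def mult_ac)
  qed
  have main: "((\<lambda>\<alpha>. c \<alpha> * D \<alpha> \<theta>) has_sum partial i g \<theta>) UNIV"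
    if \<theta>: "\<And>i. \<bar>\<theta> $ i\<bar> \<le> \<rho>" for \<theta> :: "real ^ 'd"
  proof -
    define h where "h = infsum (\<lambda>\<alpha>. c \<alpha> * D \<alpha> \<theta>) UNIV"
    have "(\<lambda>\<alpha>. norm (c \<alpha> * D \<alpha> \<theta>)) summable_on UNIV"
    proof (rule Infinite_Sum.abs_summable_on_comparison_test')
      show "(\<lambda>\<alpha>. 1 / \<rho> * M \<alpha>) summable_on UNIV"
        by (rule summable_on_cmult_right[OF M])
      show "norm (c \<alpha> * D \<alpha> \<theta>) \<le> 1 / \<rho> * M \<alpha>" for \<alpha>
        unfolding real_norm_def by (rule D[OF \<theta>])
    qed
    hence h: "((\<lambda>\<alpha>. c \<alpha> * D \<alpha> \<theta>) has_sum h) UNIV"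
      unfolding h_def by (rule has_sum_infsum[OF abs_summable_summable])
    have "DERIV (\<lambda>t. g (\<theta> + t *\<^sub>R axis i 1)) 0 :> h"
    proof (rule DERIV_quadratic_remainder[OF \<rho>])
      fix t assume t: "\<bar>t\<bar> \<le> \<rho>"
      have "\<bar>\<theta> $ j\<bar> \<le> 2 * \<rho>" "\<bar>(\<theta> + t *\<^sub>R axis i 1) $ j\<bar> \<le> 2 * \<rho>" for j
        using \<theta>[of j] t \<rho> by (auto simp: axis_def)
      note s = ser[of \<theta>, OF this(1)] ser[of "\<theta> + t *\<^sub>R axis i 1", OF this(2)]
      have "((\<lambda>\<alpha>. c \<alpha> * mpow \<alpha> (\<theta> + t *\<^sub>R axis i 1) - c \<alpha> * mpow \<alpha> \<theta> - t * (c \<alpha> * D \<alpha> \<theta>))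
          has_sum (g (\<theta> + t *\<^sub>R axis i 1) - g \<theta> - t * h)) UNIV"
        using has_sum_add[OF has_sum_add[OF s(2) has_sum_uminusI[OF s(1)]]
            has_sum_uminusI[OF has_sum_cmult_right[OF h, of t]]]
        by simp
      moreover have "((\<lambda>\<alpha>. (t / \<rho>)\<^sup>2 * M \<alpha>) has_sum (t / \<rho>)\<^sup>2 * infsum M UNIV) UNIV"
        by (intro has_sum_cmult_right has_sum_infsum M)
      ultimately have "norm (g (\<theta> + t *\<^sub>R axis i 1) - g \<theta> - t * h) \<le> (t / \<rho>)\<^sup>2 * infsum M UNIV"
        by (rule norm_infsum_le) (unfold real_norm_def, rule rem[OF \<theta> t])
      thus "\<bar>g (\<theta> + t *\<^sub>R axis i 1) - g (\<theta> + 0 *\<^sub>R axis i 1) - t * h\<bar>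
          \<le> (infsum M UNIV / \<rho>\<^sup>2) * t\<^sup>2"
        by (simp add: power_divide mult_ac)
    qed
    with h show ?thesis by (simp add: partial_def DERIV_imp_deriv)
  qed
  \<comment> \<open>Terms with \<open>\<alpha> i = 0\<close> vanish under differentiation; the
    others are exactly the image of the shift \<open>?s\<close>, and reindexing by it yields the
    coefficients of the derivative.\<close>
  let ?s = "\<lambda>\<alpha> :: 'd \<Rightarrow> nat. \<alpha>(i := Suc (\<alpha> i))"
  have inj: "inj ?s"
    by (rule inj_on_inverseI[of _ "\<lambda>\<alpha>. \<alpha>(i := \<alpha> i - 1)"]) auto
  have img: "range ?s = {\<alpha>. \<alpha> i > 0}"
  proof (intro equalityI subsetI)
    fix \<alpha> :: "'d \<Rightarrow> nat" assume "\<alpha> \<in> {\<alpha>. \<alpha> i > 0}"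
    thus "\<alpha> \<in> range ?s"
      by (intro image_eqI[of _ _ "\<alpha>(i := \<alpha> i - 1)"]) auto
  qed auto
  show ?thesis
    unfolding has_power_series_at_def
  proof (rule eventually_nhds_zero_boxI[OF \<rho>])
    fix \<theta> :: "real ^ 'd" assume \<theta>: "\<And>i. \<bar>\<theta> $ i\<bar> \<le> \<rho>"
    have "((\<lambda>\<alpha>. c \<alpha> * D \<alpha> \<theta>) has_sum partial i g \<theta>) (range ?s)"
      using main[OF \<theta>]
      by (rule has_sum_cong_neutral[THEN iffD1, rotated -1]) (auto simp: img D_def)
    hence "((\<lambda>\<alpha>. c (?s \<alpha>) * D (?s \<alpha>) \<theta>) has_sum partial i g \<theta>) UNIV"
      using has_sum_reindex[OF inj, of "\<lambda>\<alpha>. c \<alpha> * D \<alpha> \<theta>"] by (simp add: o_def)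
    moreover have "c (?s \<alpha>) * D (?s \<alpha>) \<theta> = real (Suc (\<alpha> i)) * c (?s \<alpha>) * mpow \<alpha> (\<theta> - 0)" for \<alpha>
    proof -
      have "(\<Prod>j\<in>UNIV - {i}. (\<theta> $ j) ^ (?s \<alpha>) j) = (\<Prod>j\<in>UNIV - {i}. (\<theta> $ j) ^ \<alpha> j)"
        by (intro prod.cong) auto
      thus ?thesis by (simp add: D_def mpow_split[of _ _ i])
    qed
    ultimately show "((\<lambda>\<alpha>. real (Suc (\<alpha> i)) * c (?s \<alpha>) * mpow \<alpha> (\<theta> - 0)) has_sum partial i g \<theta>) UNIV"
      by (simp only:)
  qed
qed

section \<open>Iterated partial derivatives and uniqueness of coefficients\<close>

lemma has_power_series_at_partial_funpow:
  fixes g :: "real ^ 'd \<Rightarrow> real"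
  assumes "has_power_series_at g c 0"
  shows "has_power_series_at ((partial i ^^ n) g)
           (\<lambda>\<alpha>. fact (\<alpha> i + n) / fact (\<alpha> i) * c (\<alpha>(i := \<alpha> i + n))) 0"
proof (induction n)
  case 0
  thus ?case using assms by simp
next
  case (Suc n)
  have eq: "(\<lambda>\<alpha>. real (Suc (\<alpha> i)) * (fact ((\<alpha>(i := Suc (\<alpha> i))) i + n) / fact ((\<alpha>(i := Suc (\<alpha> i))) i) *
      c (\<alpha>(i := Suc (\<alpha> i), i := (\<alpha>(i := Suc (\<alpha> i))) i + n))))
    = (\<lambda>\<alpha>. fact (\<alpha> i + Suc n) / fact (\<alpha> i) * c (\<alpha>(i := \<alpha> i + Suc n)))"
    by (rule ext) (simp del: of_nat_Suc)
  have "has_power_series_at (partial i ((partial i ^^ n) g))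
      (\<lambda>\<alpha>. fact (\<alpha> i + Suc n) / fact (\<alpha> i) * c (\<alpha>(i := \<alpha> i + Suc n))) 0"
    using has_power_series_at_partial[OF Suc, of i] unfolding eq .
  thus ?case
    by (simp only: funpow.simps o_apply)
qed

text \<open>The coordinates in \<open>xs\<close> are distinct, so each is differentiated in a single
  block; the factor and the index shift of the head do not interact with those of the tail.\<close>

lemma has_power_series_at_foldr_partial:
  fixes g :: "real ^ 'd \<Rightarrow> real" and \<alpha> :: "'d \<Rightarrow> nat"
  assumes "has_power_series_at g c 0" "distinct xs"
  shows "has_power_series_at (foldr (\<lambda>i. partial i ^^ \<alpha> i) xs g)
           (\<lambda>\<beta>. (\<Prod>i\<in>set xs. fact (\<beta> i + \<alpha> i) / fact (\<beta> i)) *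
                 c (\<lambda>i. if i \<in> set xs then \<beta> i + \<alpha> i else \<beta> i)) 0"
  using assms(2)
proof (induction xs)
  case Nil
  thus ?case using assms by simp
next
  case (Cons x xs)
  have eq: "fact (\<beta> x + \<alpha> x) / (fact (\<beta> x) :: real) *
       ((\<Prod>i\<in>set xs. fact ((\<beta>(x := \<beta> x + \<alpha> x)) i + \<alpha> i) / fact ((\<beta>(x := \<beta> x + \<alpha> x)) i)) *
        c (\<lambda>i. if i \<in> set xs then (\<beta>(x := \<beta> x + \<alpha> x)) i + \<alpha> i else (\<beta>(x := \<beta> x + \<alpha> x)) i))
     = (\<Prod>i\<in>set (x # xs). fact (\<beta> i + \<alpha> i) / fact (\<beta> i)) *
        c (\<lambda>i. if i \<in> set (x # xs) then \<beta> i + \<alpha> i else \<beta> i)" (is "?a * (?p * c ?q) = ?r * c ?s")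
    for \<beta> :: "'d \<Rightarrow> nat"
  proof -
    have "?p = (\<Prod>i\<in>set xs. fact (\<beta> i + \<alpha> i) / fact (\<beta> i))"
      using Cons.prems by (intro prod.cong) auto
    moreover have "?r = ?a * (\<Prod>i\<in>set xs. fact (\<beta> i + \<alpha> i) / fact (\<beta> i))"
      using Cons.prems unfolding list.set by (subst prod.insert) auto
    moreover have "?q = ?s"
      using Cons.prems by (auto simp: fun_eq_iff)
    ultimately show ?thesis by (simp only: mult.assoc)
  qed
  have "has_power_series_at ((partial x ^^ \<alpha> x) (foldr (\<lambda>i. partial i ^^ \<alpha> i) xs g))
      (\<lambda>\<beta>. (\<Prod>i\<in>set (x # xs). fact (\<beta> i + \<alpha> i) / fact (\<beta> i)) *
        c (\<lambda>i. if i \<in> set (x # xs) then \<beta> i + \<alpha> i else \<beta> i)) 0"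
    unfolding eq[symmetric]
    by (rule has_power_series_at_partial_funpow, rule Cons.IH) (use Cons.prems in simp)
  thus ?case
    by (simp only: foldr_Cons o_apply)
qed

lemma has_power_series_at_value:
  assumes "has_power_series_at g c 0"
  shows "g 0 = c (\<lambda>_. 0)"
proof -
  have "((\<lambda>\<alpha>. c \<alpha> * mpow \<alpha> (0 - 0)) has_sum g 0) UNIV"
    using assms eventually_nhds_x_imp_x unfolding has_power_series_at_def by fast
  moreover have "((\<lambda>\<alpha>. c \<alpha> * mpow \<alpha> (0 - 0)) has_sum c (\<lambda>_. 0)) UNIV"
    by (rule has_sum_finite_neutralI[of "{\<lambda>_. 0}"]) (auto simp: mpow_zero)
  ultimately show ?thesis by (rule has_sum_unique)
qed

text \<open>At \<open>0\<close> only the constant coefficient of the differentiated series survives.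
  In particular the coefficients are determined by the function, which is how two expansions of one
  function are compared below.\<close>

lemma mderiv_power_series:
  fixes g :: "real ^ 'd::{finite,linorder} \<Rightarrow> real"
  assumes "has_power_series_at g c 0"
  shows "mderiv \<alpha> g 0 = mfact \<alpha> * c \<alpha>"
  using has_power_series_at_value[OF has_power_series_at_foldr_partial[OF assms,
      of "sorted_list_of_set UNIV" \<alpha>]]
  by (simp add: mderiv_def mfact_def)

section \<open>Products and exponentials of power series\<close>

text \<open>The sum is finite, and the truncated subtraction is exact because
  \<open>\<alpha> \<le> \<gamma>\<close> holds pointwise.\<close>

definition cauchy_prod :: "(('d::finite \<Rightarrow> nat) \<Rightarrow> real) \<Rightarrow> (('d \<Rightarrow> nat) \<Rightarrow> real) \<Rightarrow> ('d \<Rightarrow> nat) \<Rightarrow> real"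
  where "cauchy_prod a b \<gamma> = (\<Sum>\<alpha>\<le>\<gamma>. a \<alpha> * b (\<lambda>i. \<gamma> i - \<alpha> i))"

fun cauchy_power :: "(('d::finite \<Rightarrow> nat) \<Rightarrow> real) \<Rightarrow> nat \<Rightarrow> ('d \<Rightarrow> nat) \<Rightarrow> real"
  where
    "cauchy_power a 0 = (\<lambda>\<alpha>. if \<alpha> = (\<lambda>_. 0) then 1 else 0)"
  | "cauchy_power a (Suc k) = cauchy_prod a (cauchy_power a k)"

lemma has_sum_product_real:
  fixes f :: "'a \<Rightarrow> real" and g :: "'b \<Rightarrow> real"
  assumes "(f has_sum x) A" "(g has_sum y) B"
  shows "((\<lambda>(s, t). f s * g t) has_sum x * y) (A \<times> B)"
proof (rule has_sum_SigmaI)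
  show "((\<lambda>t. case (s, t) of (s, t) \<Rightarrow> f s * g t) has_sum f s * y) B" for s
    using has_sum_cmult_right[OF assms(2)] by simp
  show "((\<lambda>s. f s * y) has_sum x * y) A"
    by (rule has_sum_cmult_left[OF assms(1)])
  have f: "(\<lambda>s. \<bar>f s\<bar>) summable_on A" and g: "(\<lambda>t. \<bar>g t\<bar>) summable_on B"
    using assms summable_on_iff_abs_summable_on_real[of f A] summable_on_iff_abs_summable_on_real[of g B]
    by (auto dest: has_sum_imp_summable)
  have "(\<lambda>p. norm (case p of (s, t) \<Rightarrow> f s * g t)) summable_on A \<times> B"
    by (rule summable_on_SigmaI[where g = "\<lambda>s. \<bar>f s\<bar> * (\<Sum>\<^sub>\<infinity>t\<in>B. \<bar>g t\<bar>)"])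
      (use f g in \<open>auto simp: abs_mult intro!: has_sum_cmult_right has_sum_infsum summable_on_cmult_left\<close>)
  thus "(\<lambda>(s, t). f s * g t) summable_on A \<times> B"
    by (rule abs_summable_summable)
qed

text \<open>The double series over \<open>(\<alpha>, \<beta>)\<close> converges absolutely, so it
  may be regrouped by the total index \<open>\<gamma> = \<alpha> + \<beta>\<close>.\<close>

lemma has_sum_cauchy_prod:
  fixes a b :: "('d::finite \<Rightarrow> nat) \<Rightarrow> real"
  assumes "((\<lambda>\<alpha>. a \<alpha> * mpow \<alpha> \<theta>) has_sum x) UNIV" "((\<lambda>\<alpha>. b \<alpha> * mpow \<alpha> \<theta>) has_sum y) UNIV"
  shows "((\<lambda>\<gamma>. cauchy_prod a b \<gamma> * mpow \<gamma> \<theta>) has_sum x * y) UNIV"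
proof -
  let ?f = "\<lambda>(\<gamma>, \<alpha>). a \<alpha> * b (\<lambda>i. \<gamma> i - \<alpha> i) * mpow \<gamma> \<theta>"
  have "((\<lambda>(\<alpha>, \<beta>). (a \<alpha> * mpow \<alpha> \<theta>) * (b \<beta> * mpow \<beta> \<theta>)) has_sum x * y) (UNIV \<times> UNIV)"
    by (rule has_sum_product_real) fact+
  also have "?this \<longleftrightarrow> (?f has_sum x * y) (SIGMA \<gamma>:UNIV. {..\<gamma>})"
    by (rule has_sum_reindex_bij_witness[of _ "\<lambda>(\<gamma>, \<alpha>). (\<alpha>, \<lambda>i. \<gamma> i - \<alpha> i)"
          "\<lambda>(\<alpha>, \<beta>). (\<lambda>i. \<alpha> i + \<beta> i, \<alpha>)"])
      (auto simp: le_fun_def mpow_add mult_ac)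
  finally have "((\<lambda>\<gamma>. \<Sum>\<alpha>\<le>\<gamma>. ?f (\<gamma>, \<alpha>)) has_sum x * y) UNIV"
    by (rule has_sum_SigmaD) (auto intro!: has_sum_finite finite_multi_index_atMost)
  thus ?thesis
    by (simp add: cauchy_prod_def sum_distrib_right)
qed

lemma has_sum_cauchy_power:
  fixes a :: "('d::finite \<Rightarrow> nat) \<Rightarrow> real"
  assumes "((\<lambda>\<alpha>. a \<alpha> * mpow \<alpha> \<theta>) has_sum x) UNIV"
  shows "((\<lambda>\<gamma>. cauchy_power a k \<gamma> * mpow \<gamma> \<theta>) has_sum x ^ k) UNIV"
proof (induction k)
  case 0
  show ?case
    by (rule has_sum_finite_neutralI[of "{\<lambda>_. 0}"]) auto
next
  case (Suc k)
  show ?case using has_sum_cauchy_prod[OF assms Suc] by simp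
qed

section \<open>The exponential of a power series\<close>

lemma abs_cauchy_power_le:
  "\<bar>cauchy_power a k \<gamma>\<bar> \<le> cauchy_power (\<lambda>\<alpha>. \<bar>a \<alpha>\<bar>) k \<gamma>"
proof (induction k arbitrary: \<gamma>)
  case (Suc k)
  show ?case
    unfolding cauchy_power.simps cauchy_prod_def
    by (rule order_trans[OF sum_abs]) (auto simp: abs_mult intro!: sum_mono mult_left_mono Suc)
qed auto

text \<open>The sum over \<open>k\<close> is infinite because the constant coefficient of
  \<open>a\<close> may be nonzero, in which case all powers can contribute to one
  \<open>\<gamma>\<close>.\<close>

definition exp_series :: "(('d::finite \<Rightarrow> nat) \<Rightarrow> real) \<Rightarrow> ('d \<Rightarrow> nat) \<Rightarrow> real"
  where "exp_series a \<gamma> = (\<Sum>\<^sub>\<infinity>k. cauchy_power a k \<gamma> / fact k)"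

lemma has_sum_exp_real: "((\<lambda>k. x ^ k / fact k) has_sum exp x) (UNIV :: nat set)" for x :: real
proof (rule norm_summable_imp_has_sum)
  show "summable (\<lambda>k. norm (x ^ k / fact k))"
    using summable_norm_exp[of x] by (simp add: field_simps)
  show "(\<lambda>k. x ^ k / fact k) sums exp x"
    using exp_converges[of x] by (simp add: field_simps)
qed

text \<open>The sums over \<open>k\<close> and \<open>\<gamma>\<close> are exchanged. This is
  justified by passing to absolute values of coefficients and coordinates: the inner sums become
  \<open>A ^ k / fact k\<close>, which is summable in \<open>k\<close>.\<close>

lemma has_sum_exp_series:
  fixes a :: "('d::finite \<Rightarrow> nat) \<Rightarrow> real"
  assumes "((\<lambda>\<alpha>. a \<alpha> * mpow \<alpha> \<theta>) has_sum x) UNIV"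
  shows "((\<lambda>\<gamma>. exp_series a \<gamma> * mpow \<gamma> \<theta>) has_sum exp x) UNIV"
proof -
  let ?f = "\<lambda>(k, \<gamma>). cauchy_power a k \<gamma> * mpow \<gamma> \<theta> / fact k"
  let ?\<theta> = "\<chi> i. \<bar>\<theta> $ i\<bar>"
  define A where "A = (\<Sum>\<^sub>\<infinity>\<alpha>. \<bar>a \<alpha>\<bar> * mpow \<alpha> ?\<theta>)"
  have "(\<lambda>\<alpha>. \<bar>a \<alpha>\<bar> * mpow \<alpha> ?\<theta>) summable_on UNIV"
    using assms summable_on_iff_abs_summable_on_real[of "\<lambda>\<alpha>. a \<alpha> * mpow \<alpha> \<theta>" UNIV]
    by (auto simp: abs_mult abs_mpow dest: has_sum_imp_summable)
  hence A: "((\<lambda>\<alpha>. \<bar>a \<alpha>\<bar> * mpow \<alpha> ?\<theta>) has_sum A) UNIV"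
    unfolding A_def by (rule has_sum_infsum)
  have nonneg: "mpow \<gamma> ?\<theta> \<ge> 0" for \<gamma>
    by (simp flip: abs_mpow)
  have nonneg': "cauchy_power (\<lambda>\<alpha>. \<bar>a \<alpha>\<bar>) k \<gamma> \<ge> 0" for k \<gamma>
    using abs_cauchy_power_le[of a k \<gamma>] by linarith
  have "(\<lambda>(k, \<gamma>). cauchy_power (\<lambda>\<alpha>. \<bar>a \<alpha>\<bar>) k \<gamma> * mpow \<gamma> ?\<theta> / fact k)
      summable_on UNIV \<times> UNIV"
  proof (rule summable_on_SigmaI)
    show "((\<lambda>\<gamma>. case (k, \<gamma>) of (k, \<gamma>) \<Rightarrow> cauchy_power (\<lambda>\<alpha>. \<bar>a \<alpha>\<bar>) k \<gamma> * mpow \<gamma> ?\<theta> / fact k)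
        has_sum A ^ k / fact k) UNIV" for k
      using has_sum_divide_const[OF has_sum_cauchy_power[OF A]] by simp
    show "(\<lambda>k. A ^ k / fact k) summable_on UNIV"
      using has_sum_exp_real by (rule has_sum_imp_summable)
  qed (use nonneg nonneg' in auto)
  hence "(\<lambda>p. norm (?f p)) summable_on UNIV \<times> UNIV"
    by (rule Infinite_Sum.abs_summable_on_comparison_test')
      (use nonneg in \<open>auto simp: abs_mult abs_mpow intro!: divide_right_mono mult_right_mono abs_cauchy_power_le\<close>)
  hence sf: "?f summable_on UNIV \<times> UNIV"
    by (rule abs_summable_summable)
  have "(?f has_sum exp x) (UNIV \<times> UNIV)"
  proof (rule has_sum_SigmaI[OF _ _ sf])
    show "((\<lambda>\<gamma>. ?f (k, \<gamma>)) has_sum x ^ k / fact k) UNIV" for k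
      using has_sum_divide_const[OF has_sum_cauchy_power[OF assms]] by simp
  qed (rule has_sum_exp_real)
  hence swap: "((\<lambda>(\<gamma>, k). cauchy_power a k \<gamma> * mpow \<gamma> \<theta> / fact k) has_sum exp x) (UNIV \<times> UNIV)"
    by (subst (asm) has_sum_swap) (simp add: case_prod_unfold)
  show ?thesis
  proof (rule has_sum_SigmaD[OF swap])
    fix \<gamma> :: "'d \<Rightarrow> nat"
    \<comment> \<open>Summability over \<open>k\<close> is obtained only with the factor
      \<open>mpow \<gamma> \<theta>\<close> present. Pulling it out of the infinite sum is still
      correct where it vanishes, both sides being \<open>0\<close> there.\<close>
    have "(\<lambda>k. cauchy_power a k \<gamma> * mpow \<gamma> \<theta> / fact k) summable_on UNIV"
      using summable_on_SigmaD1[where f = "\<lambda>\<gamma> k. cauchy_power a k \<gamma> * mpow \<gamma> \<theta> / fact k"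
          and A = UNIV and B = "\<lambda>_. UNIV" and x = \<gamma>] has_sum_imp_summable[OF swap]
      by simp
    from has_sum_infsum[OF this]
    show "((\<lambda>k. case (\<gamma>, k) of (\<gamma>, k) \<Rightarrow> cauchy_power a k \<gamma> * mpow \<gamma> \<theta> / fact k)
        has_sum exp_series a \<gamma> * mpow \<gamma> \<theta>) UNIV"
      by (simp add: exp_series_def flip: infsum_cmult_left')
  qed
qed

lemma has_power_series_at_exp:
  assumes "has_power_series_at g a 0"
  shows "has_power_series_at (\<lambda>\<theta>. exp (g \<theta>)) (exp_series a) 0"
  using assms unfolding has_power_series_at_def
  by eventually_elim (rule has_sum_exp_series)

lemma cauchy_prod_unit: "cauchy_prod a (\<lambda>\<alpha>. if \<alpha> = (\<lambda>_. 0) then 1 else 0) = a"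
proof
  fix \<gamma> :: "'a \<Rightarrow> nat"
  have "cauchy_prod a (\<lambda>\<alpha>. if \<alpha> = (\<lambda>_. 0) then 1 else 0) \<gamma>
      = (\<Sum>\<alpha>\<le>\<gamma>. if \<alpha> = \<gamma> then a \<alpha> else 0)"
    unfolding cauchy_prod_def by (intro sum.cong) (auto simp: fun_eq_iff le_fun_def intro: order_antisym)
  thus "cauchy_prod a (\<lambda>\<alpha>. if \<alpha> = (\<lambda>_. 0) then 1 else 0) \<gamma> = a \<gamma>"
    by (simp add: finite_multi_index_atMost)
qed

section \<open>Weighted orders\<close>

definition weight :: "'d::finite set \<Rightarrow> nat \<Rightarrow> ('d \<Rightarrow> nat) \<Rightarrow> nat"
  where "weight S m \<alpha> = m * (\<Sum>i\<in>S. \<alpha> i) + (\<Sum>i\<in>-S. \<alpha> i)"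

definition weight_part :: "'d::finite set \<Rightarrow> nat \<Rightarrow> nat \<Rightarrow> (('d \<Rightarrow> nat) \<Rightarrow> real) \<Rightarrow> ('d \<Rightarrow> nat) \<Rightarrow> real"
  where "weight_part S m n a \<alpha> = (if weight S m \<alpha> = n then a \<alpha> else 0)"

lemma weight_diff:
  assumes "\<alpha> \<le> \<gamma>"
  shows "weight S m \<gamma> = weight S m \<alpha> + weight S m (\<lambda>i. \<gamma> i - \<alpha> i)"
proof -
  have "\<gamma> = (\<lambda>i. \<alpha> i + (\<gamma> i - \<alpha> i))" using assms by (auto simp: le_fun_def)
  hence "weight S m \<gamma> = weight S m (\<lambda>i. \<alpha> i + (\<gamma> i - \<alpha> i))" by simp
  also have "\<dots> = weight S m \<alpha> + weight S m (\<lambda>i. \<gamma> i - \<alpha> i)"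
    unfolding weight_def sum.distrib by (simp add: algebra_simps)
  finally show ?thesis .
qed

lemma le_weight:
  assumes "m \<ge> 1"
  shows "\<alpha> i \<le> weight S m \<alpha>"
proof (cases "i \<in> S")
  case True
  hence "\<alpha> i \<le> (\<Sum>i\<in>S. \<alpha> i)" by (intro member_le_sum) auto
  also have "\<dots> \<le> m * (\<Sum>i\<in>S. \<alpha> i)" using assms by simp
  finally show ?thesis by (simp add: weight_def)
next
  case False
  hence "\<alpha> i \<le> (\<Sum>i\<in>-S. \<alpha> i)" by (intro member_le_sum) auto
  thus ?thesis by (simp add: weight_def)
qed

text \<open>With \<open>m \<ge> 1\<close> every coordinate has positive weight, so the weight bounds
  each exponent.\<close>

lemma finite_weight_eq:
  assumes "m \<ge> 1"
  shows "finite {\<alpha>. weight S m \<alpha> = n}"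
  by (rule finite_subset[OF _ finite_multi_index_atMost[of "\<lambda>_. n"]])
    (use le_weight[OF assms] in \<open>auto simp: le_fun_def\<close>)

text \<open>Weights add under multiplication, so a product of \<open>k\<close> series that start at
  weight \<open>n\<close> starts at weight \<open>k * n\<close>.\<close>

lemma cauchy_power_eq_0:
  assumes "\<And>\<alpha>. weight S m \<alpha> < n \<Longrightarrow> a \<alpha> = 0" "weight S m \<gamma> < k * n"
  shows "cauchy_power a k \<gamma> = 0"
  using assms(2)
proof (induction k arbitrary: \<gamma>)
  case (Suc k)
  have "a \<alpha> * cauchy_power a k (\<lambda>i. \<gamma> i - \<alpha> i) = 0" if "\<alpha> \<le> \<gamma>" for \<alpha>
  proof (cases "weight S m \<alpha> < n")
    case False
    hence "weight S m (\<lambda>i. \<gamma> i - \<alpha> i) < k * n"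
      using Suc.prems weight_diff[OF that, of S m] by simp
    thus ?thesis using Suc.IH by simp
  qed (use assms(1) in simp)
  thus ?case unfolding cauchy_power.simps cauchy_prod_def by (intro sum.neutral) simp
qed simp

text \<open>A nonzero product needs two weights of at least \<open>n\<close>; if their sum is at
  most \<open>2 * n\<close>, both equal \<open>n\<close>.\<close>

lemma cauchy_prod_weight_part:
  assumes "\<And>\<alpha>. weight S m \<alpha> < n \<Longrightarrow> a \<alpha> = 0" "weight S m \<gamma> \<le> 2 * n"
  shows "cauchy_prod (weight_part S m n a) (weight_part S m n a) \<gamma> = cauchy_prod a a \<gamma>"
  unfolding cauchy_prod_def
proof (intro sum.cong refl)
  fix \<alpha> assume "\<alpha> \<in> {..\<gamma>}"
  hence w: "weight S m \<alpha> + weight S m (\<lambda>i. \<gamma> i - \<alpha> i) \<le> 2 * n"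
    using assms(2) weight_diff[of \<alpha> \<gamma> S m] by simp
  show "weight_part S m n a \<alpha> * weight_part S m n a (\<lambda>i. \<gamma> i - \<alpha> i) = a \<alpha> * a (\<lambda>i. \<gamma> i - \<alpha> i)"
  proof (cases "weight S m \<alpha> < n \<or> weight S m (\<lambda>i. \<gamma> i - \<alpha> i) < n")
    case True
    thus ?thesis using assms(1) by (auto simp: weight_part_def)
  next
    case False
    thus ?thesis using w by (auto simp: weight_part_def)
  qed
qed

lemma cauchy_prod_weight_part_eq_0:
  assumes "weight S m \<gamma> \<noteq> 2 * n"
  shows "cauchy_prod (weight_part S m n a) (weight_part S m n a) \<gamma> = 0"
  unfolding cauchy_prod_def
proof (intro sum.neutral ballI)
  fix \<alpha> assume "\<alpha> \<in> {..\<gamma>}"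
  thus "weight_part S m n a \<alpha> * weight_part S m n a (\<lambda>i. \<gamma> i - \<alpha> i) = 0"
    using assms weight_diff[of \<alpha> \<gamma> S m] by (auto simp: weight_part_def)
qed

text \<open>The powers with \<open>k \<ge> 3\<close> start at weight \<open>3 * n\<close>, which
  exceeds \<open>2 * n\<close> because \<open>n \<ge> 1\<close>. Only the powers \<open>0\<close>,
  \<open>1\<close> and \<open>2\<close> reach \<open>\<gamma>\<close>.\<close>

lemma exp_series_low_weight:
  assumes "\<And>\<alpha>. weight S m \<alpha> < n \<Longrightarrow> a \<alpha> = 0" "weight S m \<gamma> \<le> 2 * n" "n \<ge> 1"
  shows "exp_series a \<gamma> = (if \<gamma> = (\<lambda>_. 0) then 1 else 0) + a \<gamma> + cauchy_prod a a \<gamma> / 2"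
proof -
  have "cauchy_power a k \<gamma> = 0" if "k \<notin> {0, 1, 2}" for k
  proof (rule cauchy_power_eq_0[OF assms(1)])
    have "2 * n < 3 * n" using assms(3) by simp
    also have "3 * n \<le> k * n" using that by (intro mult_right_mono) auto
    finally show "weight S m \<gamma> < k * n" by (rule order.strict_trans1[OF assms(2)])
  qed
  hence "((\<lambda>k. cauchy_power a k \<gamma> / fact k) has_sum (\<Sum>k\<in>{0, 1, 2}. cauchy_power a k \<gamma> / fact k)) UNIV"
    by (intro has_sum_finite_neutralI[of "{0, 1, 2}"]) auto
  hence "exp_series a \<gamma> = (\<Sum>k\<in>{0, 1, 2}. cauchy_power a k \<gamma> / fact k)"
    unfolding exp_series_def by (rule infsumI)
  thus ?thesis
    by (simp add: numeral_2_eq_2 cauchy_prod_unit)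
qed

lemma cauchy_prod_uminus: "cauchy_prod (\<lambda>\<alpha>. - a \<alpha>) (\<lambda>\<alpha>. - a \<alpha>) = cauchy_prod a a"
  by (simp add: cauchy_prod_def fun_eq_iff)

section \<open>Closure properties of power series at \<open>0\<close>\<close>

lemma has_power_series_at_finite_sum:
  assumes "finite A"
  shows "has_power_series_at (\<lambda>\<theta>. \<Sum>\<alpha>\<in>A. c \<alpha> * mpow \<alpha> \<theta>) (\<lambda>\<alpha>. if \<alpha> \<in> A then c \<alpha> else 0) 0"
  unfolding has_power_series_at_def
  by (intro always_eventually allI has_sum_finite_neutralI[of A]) (use assms in auto)

lemma has_power_series_at_add:
  assumes "has_power_series_at g a 0" "has_power_series_at h b 0"
  shows "has_power_series_at (\<lambda>\<theta>. g \<theta> + h \<theta>) (\<lambda>\<alpha>. a \<alpha> + b \<alpha>) 0"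
  using assms unfolding has_power_series_at_def
proof eventually_elim
  case (elim \<theta>)
  show ?case using has_sum_add[OF elim] by (simp add: distrib_right)
qed

lemma has_power_series_at_cmult:
  assumes "has_power_series_at g a 0"
  shows "has_power_series_at (\<lambda>\<theta>. k * g \<theta>) (\<lambda>\<alpha>. k * a \<alpha>) 0"
  using assms unfolding has_power_series_at_def
proof eventually_elim
  case (elim \<theta>)
  show ?case using has_sum_cmult_right[OF elim, of k] by (simp add: mult.assoc)
qed

lemma has_power_series_at_transform:
  assumes "has_power_series_at g c a" "\<forall>\<^sub>F \<theta> in nhds a. g \<theta> = h \<theta>"
  shows "has_power_series_at h c a"
  using assms unfolding has_power_series_at_def by eventually_elim simp

section \<open>Taylor parts in terms of weights\<close>

lemma finite_taylor_indices:
  "finite {\<alpha> :: 'd::finite \<Rightarrow> nat. (\<forall>i. i \<notin> S \<longrightarrow> \<alpha> i = 0) \<and> (\<Sum>i\<in>S. \<alpha> i) = n}"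
proof (rule finite_subset[OF _ finite_weight_eq[of 1 UNIV n]])
  show "{\<alpha> :: 'd \<Rightarrow> nat. (\<forall>i. i \<notin> S \<longrightarrow> \<alpha> i = 0) \<and> (\<Sum>i\<in>S. \<alpha> i) = n} \<subseteq> {\<alpha>. weight UNIV 1 \<alpha> = n}"
  proof (clarsimp simp: weight_def)
    fix \<alpha> :: "'d \<Rightarrow> nat" assume "\<forall>i. i \<notin> S \<longrightarrow> \<alpha> i = 0"
    thus "(\<Sum>i\<in>UNIV. \<alpha> i) = (\<Sum>i\<in>S. \<alpha> i)" by (intro sum.mono_neutral_right) auto
  qed
qed simp

text \<open>A polynomial that vanishes everywhere has zero coefficients: it and the zero series both
  represent the zero function, and \<open>mderiv_power_series\<close> applied to each compares their
  coefficients.\<close>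

lemma taylor_part_eq_0D:
  assumes "\<And>\<theta>. taylor_part S n g \<theta> = 0" "\<And>i. i \<notin> S \<Longrightarrow> \<alpha> i = 0" "(\<Sum>i\<in>S. \<alpha> i) = n"
  shows "mderiv \<alpha> g 0 = 0"
proof -
  let ?A = "{\<alpha>. (\<forall>i. i \<notin> S \<longrightarrow> \<alpha> i = 0) \<and> (\<Sum>i\<in>S. \<alpha> i) = n}"
  have A: "has_power_series_at (\<lambda>\<theta>. 0) (\<lambda>\<alpha>. if \<alpha> \<in> ?A then 1 / mfact \<alpha> * mderiv \<alpha> g 0 else 0) 0"
    using has_power_series_at_finite_sum[OF finite_taylor_indices[of S n],
        of "\<lambda>\<alpha>. 1 / mfact \<alpha> * mderiv \<alpha> g 0"] assms(1)
    unfolding taylor_part_def by simp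
  have Z: "has_power_series_at (\<lambda>\<theta>. 0) (\<lambda>\<alpha>. 0) 0"
    by (simp add: has_power_series_at_def)
  have "mfact \<alpha> * (if \<alpha> \<in> ?A then 1 / mfact \<alpha> * mderiv \<alpha> g 0 else 0) = mfact \<alpha> * 0"
    by (rule trans[OF mderiv_power_series[OF A, symmetric] mderiv_power_series[OF Z]])
  thus ?thesis using assms(2,3) by auto
qed

text \<open>A single exponent in \<open>S\<close> already costs weight \<open>m\<close>, so
  \<open>\<alpha>\<close> lives on \<open>-S\<close> and has degree below \<open>m\<close>. Degree
  \<open>0\<close> is covered by \<open>g 0 = 0\<close>, positive degree by the vanishing Taylor
  parts.\<close>

lemma mderiv_vanish_low_weight:
  assumes "g 0 = 0" "has_power_series_at g c 0"
    and "\<And>n \<theta>. n \<in> {1..<m} \<Longrightarrow> taylor_part (-S) n g \<theta> = 0"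
    and "weight S m \<alpha> < m"
  shows "mderiv \<alpha> g 0 = 0"
proof (cases "(\<Sum>i\<in>-S. \<alpha> i) = 0")
  case True
  moreover have S: "(\<Sum>i\<in>S. \<alpha> i) = 0"
    using assms(4) by (cases "\<Sum>i\<in>S. \<alpha> i") (auto simp: weight_def)
  ultimately have "\<alpha> = (\<lambda>_. 0)" by (auto simp: fun_eq_iff)
  thus ?thesis
    using mderiv_power_series[OF assms(2)] has_power_series_at_value[OF assms(2)] assms(1) by simp
next
  case False
  moreover have S: "(\<Sum>i\<in>S. \<alpha> i) = 0"
    using assms(4) by (cases "\<Sum>i\<in>S. \<alpha> i") (auto simp: weight_def)
  ultimately have n: "(\<Sum>i\<in>-S. \<alpha> i) \<in> {1..<m}"
    using assms(4) unfolding weight_def atLeastLessThan_iff by linarith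
  show ?thesis
  proof (rule taylor_part_eq_0D[OF assms(3)[OF n]])
    show "\<alpha> i = 0" if "i \<notin> - S" for i
      using S that by simp
  qed (rule refl)
qed

text \<open>Weight \<open>m\<close> arises in exactly two ways: one coordinate of \<open>S\<close>
  to the first power and nothing else, or degree \<open>m\<close> in the remaining coordinates
  alone.\<close>

lemma taylor_parts_eq_weight_part:
  assumes "m \<ge> 1"
  shows "taylor_part S 1 g \<theta> + taylor_part (-S) m g \<theta>
       = (\<Sum>\<alpha> | weight S m \<alpha> = m. mderiv \<alpha> g 0 / mfact \<alpha> * mpow \<alpha> \<theta>)"
proof -
  let ?A = "\<lambda>S n. {\<alpha>. (\<forall>i. i \<notin> S \<longrightarrow> \<alpha> i = 0) \<and> (\<Sum>i\<in>S. \<alpha> i) = n}"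
  have "{\<alpha>. weight S m \<alpha> = m} = ?A S 1 \<union> ?A (-S) m"
  proof (intro equalityI subsetI)
    fix \<alpha> assume "\<alpha> \<in> {\<alpha>. weight S m \<alpha> = m}"
    hence w: "m * (\<Sum>i\<in>S. \<alpha> i) + (\<Sum>i\<in>-S. \<alpha> i) = m" by (simp add: weight_def)
    hence "m * (\<Sum>i\<in>S. \<alpha> i) \<le> m * 1" by linarith
    hence "(\<Sum>i\<in>S. \<alpha> i) \<le> 1" using assms by simp
    hence "(\<Sum>i\<in>S. \<alpha> i) = 0 \<or> (\<Sum>i\<in>S. \<alpha> i) = 1" by linarith
    thus "\<alpha> \<in> ?A S 1 \<union> ?A (-S) m" using w by fastforce
  qed (auto simp: weight_def)
  moreover have "?A S 1 \<inter> ?A (-S) m = {}" by auto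
  ultimately have "(\<Sum>\<alpha> | weight S m \<alpha> = m. mderiv \<alpha> g 0 / mfact \<alpha> * mpow \<alpha> \<theta>)
      = (\<Sum>\<alpha>\<in>?A S 1. mderiv \<alpha> g 0 / mfact \<alpha> * mpow \<alpha> \<theta>)
      + (\<Sum>\<alpha>\<in>?A (-S) m. mderiv \<alpha> g 0 / mfact \<alpha> * mpow \<alpha> \<theta>)"
    by (simp only: sum.union_disjoint finite_taylor_indices)
  thus ?thesis
    unfolding taylor_part_def by simp
qed

text \<open>The square is homogeneous of weight \<open>2 * m\<close>. Reading both finite sums as
  power series reduces the identity to uniqueness of sums.\<close>

lemma square_weight_part:
  assumes "m \<ge> 1"
  shows "(\<Sum>\<alpha> | weight S m \<alpha> = m. a \<alpha> * mpow \<alpha> \<theta>)\<^sup>2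
       = (\<Sum>\<gamma> | weight S m \<gamma> = 2 * m.
            cauchy_prod (weight_part S m m a) (weight_part S m m a) \<gamma> * mpow \<gamma> \<theta>)"
proof -
  have "((\<lambda>\<alpha>. weight_part S m m a \<alpha> * mpow \<alpha> \<theta>) has_sum
      (\<Sum>\<alpha> | weight S m \<alpha> = m. a \<alpha> * mpow \<alpha> \<theta>)) UNIV"
    by (rule has_sum_finite_neutralI[of "{\<alpha>. weight S m \<alpha> = m}"])
      (auto simp: weight_part_def finite_weight_eq[OF assms])
  from has_sum_cauchy_prod[OF this this] show ?thesis
    unfolding power2_eq_square
  proof (rule has_sum_unique)
    show "((\<lambda>\<gamma>. cauchy_prod (weight_part S m m a) (weight_part S m m a) \<gamma> * mpow \<gamma> \<theta>) has_sum
        (\<Sum>\<gamma> | weight S m \<gamma> = 2 * m.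
            cauchy_prod (weight_part S m m a) (weight_part S m m a) \<gamma> * mpow \<gamma> \<theta>)) UNIV"
      by (rule has_sum_finite_neutralI[of "{\<alpha>. weight S m \<alpha> = 2 * m}"])
        (auto simp: cauchy_prod_weight_part_eq_0 finite_weight_eq[OF assms])
  qed
qed

section \<open>The log-likelihood ratio\<close>

lemma llr_zero: "llr p x 0 = 0"
  by (simp add: llr_def)

lemma ratio_eq_exp_llr:
  assumes "0 < p x 0" "0 < p x \<theta>"
  shows "p x \<theta> / p x 0 = exp (- llr p x \<theta>)"
  using assms by (simp add: llr_def exp_minus)

text \<open>The law of \<open>X\<close> has a density with respect to \<open>\<mu>\<close>, so null
  sets of \<open>\<mu>\<close> are null for it.\<close>

lemma AE_distributed:
  assumes "distributed P \<mu> X f" "AE x in \<mu>. Q x"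
  shows "AE \<omega> in P. Q (X \<omega>)"
proof (rule AE_distrD[where P = Q])
  show "X \<in> measurable P \<mu>" using assms(1) by (rule distributed_measurable)
  have "AE x in density \<mu> f. Q x"
    using assms distributed_borel_measurable[OF assms(1)] by (subst AE_density) auto
  thus "AE x in distr P \<mu> X. Q x"
    unfolding distributed_distr_eq_density[OF assms(1)] .
qed

text \<open>Integrating against the law of \<open>X\<close>, whose density is \<open>p x 0\<close>
  almost everywhere, cancels the denominator; positivity of \<open>p x 0\<close> excludes division
  by zero outside a null set.\<close>

lemma expectation_likelihood_ratio:
  fixes p :: "'x \<Rightarrow> 'p::zero \<Rightarrow> real"
  assumes model: "density_family \<mu> \<Theta> p" and mem: "0 \<in> \<Theta>" "\<theta> \<in> \<Theta>"
    and pos: "AE x in \<mu>. 0 < p x 0"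
    and dist: "distributed P \<mu> X (\<lambda>x. ennreal (q x))" and q: "AE x in \<mu>. q x = p x 0"
  shows "(\<integral>\<omega>. p (X \<omega>) \<theta> / p (X \<omega>) 0 \<partial>P) = 1"
proof -
  have meas [measurable]: "(\<lambda>x. p x 0) \<in> borel_measurable \<mu>" "(\<lambda>x. p x \<theta>) \<in> borel_measurable \<mu>"
    using model mem by (auto simp: density_family_def)
  have "density \<mu> (\<lambda>x. ennreal (q x)) = density \<mu> (\<lambda>x. ennreal (p x 0))"
    using q distributed_borel_measurable[OF dist] by (intro density_cong) auto
  hence "distributed P \<mu> X (\<lambda>x. ennreal (p x 0))"
    using dist by (simp add: distributed_def)
  hence "(\<integral>\<omega>. p (X \<omega>) \<theta> / p (X \<omega>) 0 \<partial>P) = (\<integral>x. p x 0 * (p x \<theta> / p x 0) \<partial>\<mu>)"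
    using model mem by (intro distributed_integral[symmetric]) (auto simp: density_family_def)
  also have "\<dots> = (\<integral>x. p x \<theta> \<partial>\<mu>)"
  proof (rule integral_cong_AE)
    show "AE x in \<mu>. p x 0 * (p x \<theta> / p x 0) = p x \<theta>"
      using pos by eventually_elim simp
  qed measurable
  also have "\<dots> = 1" using model mem by (simp add: density_family_def)
  finally show ?thesis .
qed

theorem theorem1:
  fixes P :: "'w measure" and X :: "'w \<Rightarrow> 'x" and \<mu> :: "'x measure"
    and q :: "'x \<Rightarrow> real" and p :: "'x \<Rightarrow> real ^ 'd::{finite,linorder} \<Rightarrow> real"
    and \<Theta> U :: "(real ^ 'd::{finite,linorder}) set" and r m :: nat
  assumes model: "density_family \<mu> \<Theta> p"
    and nbhd: "open U" "0 \<in> U" "U \<subseteq> \<Theta>"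
    and pos: "AE x in \<mu>. \<forall>\<theta>\<in>U. 0 < p x \<theta>"
    and prob: "prob_space P"
    and true_density: "distributed P \<mu> X (\<lambda>x. ennreal (q x))"
    and realizable: "AE x in \<mu>. q x = p x 0"
    and L2: "\<forall>\<theta>\<in>U. integrable P (\<lambda>\<omega>. (llr p (X \<omega>) \<theta>)\<^sup>2)"
    and f_analytic: "AE x in \<mu>. real_analytic_at (llr p x) 0"
    and K_analytic: "real_analytic_at (KL P X p) 0"
    and interchange_f: "expectation_deriv_interchange P (\<lambda>\<omega>. llr p (X \<omega>))"
    and interchange_p: "expectation_deriv_interchange P (\<lambda>\<omega> \<theta>. p (X \<omega>) \<theta> / p (X \<omega>) 0)"
    and rank: "r = rank (fisher_information P X p)"
    and semi_regular: "r > 0"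
    and A1: "lin_indep_rvs P (first_coords r) (\<lambda>i \<omega>. partial i (llr p (X \<omega>)) 0)"
    and A2: "if r = CARD('d) then m = 1
             else m \<ge> 1 \<and>
               taylor_parts_vanish_below P (\<lambda>\<omega>. llr p (X \<omega>)) (- first_coords r) m \<and>
               (\<forall>k>m. \<not> taylor_parts_vanish_below P (\<lambda>\<omega>. llr p (X \<omega>)) (- first_coords r) k)"
  shows "(\<forall>\<theta>. integrable P (\<lambda>\<omega>. (taylor_part (first_coords r) 1 (llr p (X \<omega>)) \<theta>
                               + taylor_part (- first_coords r) m (llr p (X \<omega>)) \<theta>)\<^sup>2)) \<and>
    (\<exists>R c. has_power_series_at R c 0 \<and>
      (\<forall>\<^sub>F \<theta> in nhds 0. KL P X p \<theta> =
         1 / 2 * (\<integral>\<omega>. (taylor_part (first_coords r) 1 (llr p (X \<omega>)) \<theta>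
                     + taylor_part (- first_coords r) m (llr p (X \<omega>)) \<theta>)\<^sup>2 \<partial>P) + R \<theta>) \<and>
      (\<forall>\<alpha>. (\<forall>i\<in>first_coords r. \<alpha> i = 0) \<and> (\<Sum>i\<in>- first_coords r. \<alpha> i) \<le> 2 * m
         \<longrightarrow> c \<alpha> = 0) \<and>
      (\<forall>\<alpha>. (\<Sum>i\<in>first_coords r. \<alpha> i) = 1 \<and> (\<Sum>i\<in>- first_coords r. \<alpha> i) \<le> m
         \<longrightarrow> c \<alpha> = 0) \<and>
      (\<forall>\<alpha>. (\<forall>i\<in>- first_coords r. \<alpha> i = 0) \<and> (\<Sum>i\<in>first_coords r. \<alpha> i) = 2
         \<longrightarrow> c \<alpha> = 0))"
proof -
  interpret prob_space P by (rule prob)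
  let ?S = "first_coords r :: 'd set"
  define f where "f \<omega> = llr p (X \<omega>)" for \<omega>
  define g where "g \<omega> \<theta> = p (X \<omega>) \<theta> / p (X \<omega>) 0" for \<omega> \<theta>
  define a where "a \<omega> \<alpha> = mderiv \<alpha> (f \<omega>) 0 / mfact \<alpha>" for \<omega> \<alpha>
  define B where "B \<gamma> \<omega> = cauchy_prod (weight_part ?S m m (a \<omega>)) (weight_part ?S m m (a \<omega>)) \<gamma>" for \<gamma> \<omega>
  let ?F = "\<lambda>\<omega> \<theta>. taylor_part ?S 1 (f \<omega>) \<theta> + taylor_part (- ?S) m (f \<omega>) \<theta>"
  \<comment> \<open>For \<open>r = CARD('d)\<close> the convention gives \<open>m = 1\<close>; then
    \<open>{1..<m}\<close> is empty and the vanishing condition holds trivially.\<close>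
  have m: "m \<ge> 1" and vanish: "taylor_parts_vanish_below P f (- ?S) m"
    using A2 by (auto simp: f_def[abs_def] taylor_parts_vanish_below_def split: if_splits)
  obtain cK where cK: "has_power_series_at (KL P X p) cK 0"
    using K_analytic by (auto simp: real_analytic_at_def)
  have KL_eq: "KL P X p = (\<lambda>\<theta>. \<integral>\<omega>. f \<omega> \<theta> \<partial>P)"
    by (simp add: KL_def fun_eq_iff f_def)

  \<comment> \<open>Expected Taylor coefficients of \<open>f\<close> and of the likelihood ratio
    \<open>g\<close>\<close>
  have int_a: "integrable P (\<lambda>\<omega>. a \<omega> \<alpha>)" and exp_a: "(\<integral>\<omega>. a \<omega> \<alpha> \<partial>P) = cK \<alpha>" for \<alpha>
  proof -
    have "integrable P (\<lambda>\<omega>. mderiv \<alpha> (f \<omega>) 0)"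
      and eq: "mderiv \<alpha> (KL P X p) 0 = (\<integral>\<omega>. mderiv \<alpha> (f \<omega>) 0 \<partial>P)"
      using interchange_f by (auto simp: expectation_deriv_interchange_def KL_eq f_def)
    thus "integrable P (\<lambda>\<omega>. a \<omega> \<alpha>)" by (simp add: a_def)
    show "(\<integral>\<omega>. a \<omega> \<alpha> \<partial>P) = cK \<alpha>"
      using eq mderiv_power_series[OF cK, of \<alpha>] by (simp add: a_def divide_eq_eq mult.commute)
  qed

  have int_g: "integrable P (\<lambda>\<omega>. mderiv \<alpha> (g \<omega>) 0)"
    and exp_g: "\<alpha> \<noteq> (\<lambda>_. 0) \<Longrightarrow> (\<integral>\<omega>. mderiv \<alpha> (g \<omega>) 0 \<partial>P) = 0" for \<alpha>
  proof -
    show "integrable P (\<lambda>\<omega>. mderiv \<alpha> (g \<omega>) 0)"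
      using interchange_p by (simp add: expectation_deriv_interchange_def g_def[abs_def])
    have pos0: "AE x in \<mu>. 0 < p x 0"
      using pos by eventually_elim (use nbhd in auto)
    have one: "(\<integral>\<omega>. g \<omega> \<theta> \<partial>P) = 1" if "\<theta> \<in> U" for \<theta>
      unfolding g_def
      by (rule expectation_likelihood_ratio[OF model _ _ pos0 true_density realizable]) (use nbhd that in auto)
    \<comment> \<open>The expectation of \<open>g\<close> is constantly \<open>1\<close> on
      \<open>U\<close>, so its series is that of a constant and every derivative of positive order
      at \<open>0\<close> vanishes.\<close>
    have "\<forall>\<^sub>F \<theta> in nhds 0. (\<Sum>\<alpha>\<in>{\<lambda>_. 0}. 1 * mpow \<alpha> \<theta>) = (\<integral>\<omega>. g \<omega> \<theta> \<partial>P)"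
      using eventually_nhds_in_open[OF nbhd(1,2)] by eventually_elim (simp add: one)
    hence "has_power_series_at (\<lambda>\<theta>. \<integral>\<omega>. g \<omega> \<theta> \<partial>P) (\<lambda>\<alpha>. if \<alpha> \<in> {\<lambda>_. 0} then 1 else 0) 0"
      by (intro has_power_series_at_transform[OF has_power_series_at_finite_sum]) auto
    from mderiv_power_series[OF this, of \<alpha>]
    show "(\<integral>\<omega>. mderiv \<alpha> (g \<omega>) 0 \<partial>P) = 0" if "\<alpha> \<noteq> (\<lambda>_. 0)"
      using that interchange_p by (simp add: expectation_deriv_interchange_def g_def[abs_def])
  qed

  \<comment> \<open>Almost sure expansion of the likelihood ratio up to weight
    \<open>2 * m\<close>\<close>
  have series: "AE \<omega> in P. has_power_series_at (f \<omega>) (a \<omega>) 0"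
    using AE_distributed[OF true_density f_analytic]
  proof eventually_elim
    case (elim \<omega>)
    then obtain c where c: "has_power_series_at (f \<omega>) c 0"
      by (auto simp: real_analytic_at_def f_def)
    moreover have "a \<omega> = c"
      using mderiv_power_series[OF c] by (simp add: a_def fun_eq_iff)
    ultimately show ?case by simp
  qed

  have "AE \<omega> in P. \<forall>n\<in>{1..<m}. \<forall>\<theta>. taylor_part (- ?S) n (f \<omega>) \<theta> = 0"
    using vanish by (intro AE_finite_allI) (auto simp: taylor_parts_vanish_below_def)
  with series have low: "AE \<omega> in P. \<forall>\<alpha>. weight ?S m \<alpha> < m \<longrightarrow> a \<omega> \<alpha> = 0"
  proof eventually_elim
    case (elim \<omega>)
    show ?case
    proof (intro allI impI)
      fix \<alpha> assume "weight ?S m \<alpha> < m"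
      hence "mderiv \<alpha> (f \<omega>) 0 = 0"
        by (intro mderiv_vanish_low_weight[OF _ elim(1)]) (use elim(2) in \<open>auto simp: f_def llr_zero\<close>)
      thus "a \<omega> \<alpha> = 0" by (simp add: a_def)
    qed
  qed

  have expansion: "AE \<omega> in P. \<forall>\<gamma>. weight ?S m \<gamma> \<le> 2 * m \<longrightarrow>
      mderiv \<gamma> (g \<omega>) 0 / mfact \<gamma> = (if \<gamma> = (\<lambda>_. 0) then 1 else 0) - a \<omega> \<gamma> + B \<gamma> \<omega> / 2"
    using series low AE_distributed[OF true_density pos]
  proof eventually_elim
    case (elim \<omega>)
    have low': "weight ?S m \<alpha> < m \<Longrightarrow> a \<omega> \<alpha> = 0" for \<alpha>
      using elim(2) by simp
    \<comment> \<open>On \<open>U\<close> both densities are positive, so \<open>g\<close> is the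
      exponential of \<open>-f\<close> there, and its derivatives at \<open>0\<close> can be read
      off from \<open>exp_series\<close>.\<close>
    have "\<forall>\<^sub>F \<theta> in nhds 0. exp (-1 * f \<omega> \<theta>) = g \<omega> \<theta>"
      using eventually_nhds_in_open[OF nbhd(1,2)]
    proof eventually_elim
      case (elim \<theta>)
      thus ?case
        using ratio_eq_exp_llr[of p "X \<omega>" \<theta>] \<open>\<forall>\<theta>\<in>U. 0 < p (X \<omega>) \<theta>\<close> nbhd(2)
        by (simp add: g_def f_def)
    qed
    hence g: "has_power_series_at (g \<omega>) (exp_series (\<lambda>\<alpha>. -1 * a \<omega> \<alpha>)) 0"
      by (rule has_power_series_at_transform[OF has_power_series_at_exp[OF
              has_power_series_at_cmult[OF elim(1)]]])
    show ?case
    proof (intro allI impI)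
      fix \<gamma> assume \<gamma>: "weight ?S m \<gamma> \<le> 2 * m"
      have "mderiv \<gamma> (g \<omega>) 0 / mfact \<gamma> = exp_series (\<lambda>\<alpha>. - a \<omega> \<alpha>) \<gamma>"
        using mderiv_power_series[OF g, of \<gamma>] by (simp add: divide_eq_eq mult.commute)
      also have "\<dots> = (if \<gamma> = (\<lambda>_. 0) then 1 else 0) - a \<omega> \<gamma> + cauchy_prod (a \<omega>) (a \<omega>) \<gamma> / 2"
        using low' exp_series_low_weight[OF _ \<gamma> m, of "\<lambda>\<alpha>. - a \<omega> \<alpha>"]
        by (simp add: cauchy_prod_uminus)
      also have "cauchy_prod (a \<omega>) (a \<omega>) \<gamma> = B \<gamma> \<omega>"
        unfolding B_def using low' \<gamma> by (rule cauchy_prod_weight_part[symmetric])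
      finally show "mderiv \<gamma> (g \<omega>) 0 / mfact \<gamma>
        = (if \<gamma> = (\<lambda>_. 0) then 1 else 0) - a \<omega> \<gamma> + B \<gamma> \<omega> / 2" .
    qed
  qed

  \<comment> \<open>Expected coefficients of the square and of the divergence\<close>
  have B_zero: "B \<gamma> \<omega> = 0" if "weight ?S m \<gamma> \<noteq> 2 * m" for \<gamma> \<omega>
    unfolding B_def by (rule cauchy_prod_weight_part_eq_0[OF that])
  \<comment> \<open>\<open>B \<gamma>\<close> is a sum of products of integrable variables; at this
    stage this gives measurability only.\<close>
  have meas_B: "B \<gamma> \<in> borel_measurable P" for \<gamma>
  proof -
    have [measurable]: "(\<lambda>\<omega>. weight_part ?S m m (a \<omega>) \<alpha>) \<in> borel_measurable P" for \<alpha>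
      using int_a[of \<alpha>] by (simp add: weight_part_def)
    show ?thesis
      unfolding B_def[abs_def] cauchy_prod_def by measurable
  qed
  have B_top: "integrable P (B \<gamma>) \<and> (\<integral>\<omega>. B \<gamma> \<omega> \<partial>P) = 2 * cK \<gamma>"
    if \<gamma>: "weight ?S m \<gamma> = 2 * m" for \<gamma>
  proof -
    have nz: "\<gamma> \<noteq> (\<lambda>_. 0)" using \<gamma> m by (auto simp: weight_def)
    \<comment> \<open>\<open>?h\<close> is the expansion solved for \<open>B \<gamma>\<close>. It is
      linear in integrable coefficients, so it supplies both the integrability and the expectation
      of \<open>B \<gamma>\<close>, the coefficient of \<open>g\<close> having mean
      \<open>0\<close>.\<close>
    let ?h = "\<lambda>\<omega>. 2 * (mderiv \<gamma> (g \<omega>) 0 / mfact \<gamma> + a \<omega> \<gamma>)"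
    have h: "integrable P ?h" using int_g int_a by simp
    have ae: "AE \<omega> in P. ?h \<omega> = B \<gamma> \<omega>"
      using expansion by eventually_elim (use \<gamma> nz in auto)
    have "integrable P (B \<gamma>)"
      using h ae meas_B by (subst integrable_cong_AE[symmetric]) auto
    moreover have "(\<integral>\<omega>. B \<gamma> \<omega> \<partial>P) = (\<integral>\<omega>. ?h \<omega> \<partial>P)"
      using h ae meas_B by (intro integral_cong_AE) auto
    moreover have "(\<integral>\<omega>. ?h \<omega> \<partial>P) = 2 * cK \<gamma>"
      using int_g[of \<gamma>] int_a[of \<gamma>] exp_g[OF nz] exp_a[of \<gamma>] by simp
    ultimately show ?thesis by simp
  qed
  have cK_low: "cK \<gamma> = 0" if \<gamma>: "weight ?S m \<gamma> < 2 * m" for \<gamma>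
  proof (cases "\<gamma> = (\<lambda>_. 0)")
    case True
    thus ?thesis
      using has_power_series_at_value[OF cK] by (simp add: KL_def llr_zero)
  next
    case False
    \<comment> \<open>Below weight \<open>2 * m\<close> the quadratic term \<open>B \<gamma>\<close>
      vanishes identically, so the coefficients of \<open>g\<close> and \<open>f\<close> cancel
      almost surely; the former has mean \<open>0\<close>, hence so has the latter.\<close>
    have "(\<integral>\<omega>. mderiv \<gamma> (g \<omega>) 0 / mfact \<gamma> + a \<omega> \<gamma> \<partial>P) = (\<integral>\<omega>. 0 \<partial>P)"
    proof (rule integral_cong_AE)
      show "AE \<omega> in P. mderiv \<gamma> (g \<omega>) 0 / mfact \<gamma> + a \<omega> \<gamma> = 0"
        using expansion by eventually_elim (use \<gamma> False B_zero[of \<gamma>] in auto)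
    qed (use int_g[of \<gamma>] int_a[of \<gamma>] in auto)
    thus ?thesis
      using int_g[of \<gamma>] int_a[of \<gamma>] exp_g[OF False] exp_a[of \<gamma>] by simp
  qed

  \<comment> \<open>The remainder and its coefficients\<close>
  let ?W = "{\<gamma>. weight ?S m \<gamma> = 2 * m}"
  have sq: "(?F \<omega> \<theta>)\<^sup>2 = (\<Sum>\<gamma>\<in>?W. B \<gamma> \<omega> * mpow \<gamma> \<theta>)" for \<omega> \<theta>
    using square_weight_part[OF m, where S = ?S and a = "a \<omega>" and \<theta> = \<theta>]
    by (simp only: taylor_parts_eq_weight_part[OF m] a_def B_def)
  have int_sq: "integrable P (\<lambda>\<omega>. (?F \<omega> \<theta>)\<^sup>2)" for \<theta>
    unfolding sq using B_top by (intro Bochner_Integration.integrable_sum integrable_mult_left) auto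
  have exp_sq: "(\<integral>\<omega>. (?F \<omega> \<theta>)\<^sup>2 \<partial>P) = (\<Sum>\<gamma>\<in>?W. 2 * cK \<gamma> * mpow \<gamma> \<theta>)" for \<theta>
    unfolding sq using B_top by (subst Bochner_Integration.integral_sum) auto

  define R where "R \<theta> = KL P X p \<theta> + - 1 / 2 * (\<integral>\<omega>. (?F \<omega> \<theta>)\<^sup>2 \<partial>P)" for \<theta>
  define c where "c \<gamma> = cK \<gamma> + - 1 / 2 * (if \<gamma> \<in> ?W then 2 * cK \<gamma> else 0)" for \<gamma>
  have R: "has_power_series_at R c 0"
    unfolding R_def[abs_def] c_def[abs_def] exp_sq
    by (intro has_power_series_at_add has_power_series_at_cmult has_power_series_at_finite_sum
        finite_weight_eq m cK)
  \<comment> \<open>At weight exactly \<open>2 * m\<close> the coefficient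
    \<open>cK \<gamma>\<close> is cancelled by half of the expected coefficient of the square; below
    that weight both are \<open>0\<close>.\<close>
  have c_low: "c \<gamma> = 0" if "weight ?S m \<gamma> \<le> 2 * m" for \<gamma>
    using cK_low[of \<gamma>] that by (cases "weight ?S m \<gamma> = 2 * m") (auto simp: c_def)
  show ?thesis
  proof (intro conjI exI[of _ R] exI[of _ c] allI impI R)
    show "integrable P (\<lambda>\<omega>. (taylor_part ?S 1 (llr p (X \<omega>)) \<theta>
        + taylor_part (- ?S) m (llr p (X \<omega>)) \<theta>)\<^sup>2)" for \<theta>
      using int_sq[of \<theta>] unfolding f_def .
    show "\<forall>\<^sub>F \<theta> in nhds 0. KL P X p \<theta> =
        1 / 2 * (\<integral>\<omega>. (taylor_part ?S 1 (llr p (X \<omega>)) \<theta>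
          + taylor_part (- ?S) m (llr p (X \<omega>)) \<theta>)\<^sup>2 \<partial>P) + R \<theta>"
      by (simp add: R_def f_def)
  next
    \<comment> \<open>The three excluded families have weight at most \<open>2 * m\<close>: pure
      terms in the remaining coordinates by their degree, mixed terms by \<open>m * 1 + m\<close>,
      and quadratic terms in the first coordinates by \<open>m * 2\<close>.\<close>
    fix \<alpha> :: "'d \<Rightarrow> nat"
    assume "(\<forall>i\<in>?S. \<alpha> i = 0) \<and> (\<Sum>i\<in>- ?S. \<alpha> i) \<le> 2 * m"
    thus "c \<alpha> = 0" by (intro c_low) (simp add: weight_def)
  next
    fix \<alpha> :: "'d \<Rightarrow> nat"
    assume "(\<Sum>i\<in>?S. \<alpha> i) = 1 \<and> (\<Sum>i\<in>- ?S. \<alpha> i) \<le> m"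
    thus "c \<alpha> = 0" by (intro c_low) (simp add: weight_def)
  next
    fix \<alpha> :: "'d \<Rightarrow> nat"
    assume "(\<forall>i\<in>- ?S. \<alpha> i = 0) \<and> (\<Sum>i\<in>?S. \<alpha> i) = 2"
    thus "c \<alpha> = 0" by (intro c_low) (simp add: weight_def)
  qed
qed

end
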